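(* The misère remoteness $R^-$ of paths satisfies: 1. $R^-(P_1)=R^-(P_2)=1$; 2. $R^-(P_n)=2$ for every $n\ge 3$.
   Context: For $n\ge 0$, $P_n$ denotes the path on $n$ vertices ($P_0$ is the empty graph). A Node-Kayles move on a path $P_k$ with $k\ge 1$ chooses a vertex and deletes it together with its neighbours. The possible results are: $P_0$ if $k\in\{1,2\}$; $P_0$ or $P_1$ if $k=3$; and, for $k\ge 4$, $P_{k-2}$, $P_{k-3}$, or two paths $P_i,P_j$ with $j\ge i\ge1$, $i+j=k-3$. In the conjunctive compound game, a position $G$ is a finite multiset of paths (components). A move replaces every component simultaneously by the result of a Node-Kayles move on it; a split component yields two components. The set $O(G)$ of options of $G$ consists of all positions obtainable by one such move. In particular $O(G)=\emptyset$ as soon as some component is $P_0$. The misère remoteness $R^-$ is defined recursively as follows: - $R^-(G)=0$ if $O(G)=\emptyset$; - $R^-(G)=1+\min\{R^-(G'):G'\in O(G),\ R^-(G')\text{ odd}\}$ if some option has odd remoteness; - $R^-(G)=1+\max\{R^-(G'):G'\in O(G)\}$ otherwise, in which case all these values are even. $R^-(P_n)$ denotes the remoteness of the position consisting of the single component $P_n$. *)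

theory Defs
  imports "HOL-Library.Multiset"
begin

text \<open>
  A path is represented by its number of vertices and a position by the multiset of its components.
  The empty graph counts as a component \<open>0\<close>: a move that deletes every vertex of a component
  leaves \<open>{#0#}\<close>, whereas pieces of size \<open>0\<close> beside a nonempty piece are dropped.
\<close>

definition path_moves :: "nat \<Rightarrow> nat multiset set" where
  "path_moves k =
    (if k = 0 then {}
     else if k = 1 \<or> k = 2 then {{#0#}}
     else if k = 3 then {{#0#}, {#1#}}
     else {{#k - 2#}, {#k - 3#}} \<union> {{#i, j#} | i j. 1 \<le> i \<and> i \<le> j \<and> i + j = k - 3})"

text \<open>
  The table agrees with deleting a vertex \<open>v\<close> of the path \<open>1, \<dots>, k\<close> together with
  its neighbours.
\<close>

definition remaining_pieces :: "nat \<Rightarrow> nat \<Rightarrow> nat multiset" where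
  "remaining_pieces k v =
    (let l = card {u \<in> {1..k}. u + 1 < v}; r = card {u \<in> {1..k}. v + 1 < u}
     in if l = 0 \<and> r = 0 then {#0#} else filter_mset (\<lambda>m. m \<noteq> 0) {#l, r#})"

lemma remaining_pieces_eq:
  assumes "v \<in> {1..k}"
  shows "remaining_pieces k v =
    (if v \<le> 2 \<and> k \<le> v + 1 then {#0#} else filter_mset (\<lambda>m. m \<noteq> 0) {#v - 2, k - (v + 1)#})"
proof -
  have "{u \<in> {1..k}. u + 1 < v} = {1..v - 2}" "{u \<in> {1..k}. v + 1 < u} = {v + 2..k}"
    using assms by auto
  then show ?thesis
    by (auto simp: remaining_pieces_def Let_def)
qed

lemma path_moves_eq_vertex_deletions: "path_moves k = remaining_pieces k ` {1..k}"
proof (cases "k \<le> 3")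
  case True
  then consider "k = 0" | "k = 1" | "k = 2" | "k = 3" by linarith
  then show ?thesis
  proof cases
    case 1
    then show ?thesis by (simp add: path_moves_def)
  next
    case 2
    then show ?thesis by (simp add: path_moves_def remaining_pieces_eq)
  next
    case 3
    have "{1..2::nat} = {1, 2}" by auto
    with 3 show ?thesis by (simp add: path_moves_def remaining_pieces_eq)
  next
    case 4
    have "{1..3::nat} = {1, 2, 3}" by auto
    with 4 show ?thesis by (auto simp: path_moves_def remaining_pieces_eq)
  qed
next
  case False
  show ?thesis
  proof (intro equalityI subsetI)
    fix r assume "r \<in> path_moves k"
    with False consider "r = {#k - 2#}" | "r = {#k - 3#}"
      | i j where "r = {#i, j#}" "1 \<le> i" "i \<le> j" "i + j = k - 3"
      by (auto simp: path_moves_def)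
    then show "r \<in> remaining_pieces k ` {1..k}"
    proof cases
      case 1
      with False show ?thesis
        by (intro image_eqI[of _ _ 1]) (auto simp: remaining_pieces_eq)
    next
      case 2
      with False show ?thesis
        by (intro image_eqI[of _ _ 2]) (auto simp: remaining_pieces_eq)
    next
      case 3
      then have "k - (i + 2 + 1) = j" by linarith
      with False 3 show ?thesis
        by (intro image_eqI[of _ _ "i + 2"]) (auto simp: remaining_pieces_eq)
    qed
  next
    fix r assume "r \<in> remaining_pieces k ` {1..k}"
    then obtain v where v: "1 \<le> v" "v \<le> k" and r: "r = remaining_pieces k v" by auto
    consider "v = 1" | "v = 2" | "v = k" | "v = k - 1" | "3 \<le> v" "v + 2 \<le> k"
      using v by linarith
    then show "r \<in> path_moves k"
    proof cases
      case 5
      then obtain i j where ij: "v = i + 2" "k = i + j + 3" "1 \<le> i" "1 \<le> j"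
        by (intro that[of "v - 2" "k - v - 1"]) auto
      then have "r = {#i, j#}" "r = {#j, i#}"
        using r v by (auto simp: remaining_pieces_eq add_mset_commute)
      moreover have "i + j = k - 3" "j + i = k - 3" "i \<le> j \<or> j \<le> i"
        using ij by auto
      ultimately have "\<exists>i' j'. r = {#i', j'#} \<and> 1 \<le> i' \<and> i' \<le> j' \<and> i' + j' = k - 3"
        using ij by blast
      then show ?thesis
        using False by (auto simp: path_moves_def)
    qed (use False v r in \<open>auto simp: path_moves_def remaining_pieces_eq\<close>)
  qed
qed

text \<open>
  A move chooses one result for every component, occurrences of equal components being treated
  independently. The empty multiset, which never arises from a nonempty position, is given
  no options; the vacuous move would otherwise lead from it to itself.
\<close>

definition options :: "nat multiset \<Rightarrow> nat multiset set" where
  "options G =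
    (if G = {#} then {}
     else {\<Sum>\<^sub># M | M :: nat multiset multiset. rel_mset (\<lambda>k r. r \<in> path_moves k) G M})"

lemma options_empty_if_zero_component:
  assumes "0 \<in># G"
  shows "options G = {}"
proof -
  obtain H where "G = add_mset 0 H" using assms by (metis mset_add)
  then show ?thesis
    by (auto simp: options_def path_moves_def dest!: msed_rel_invL)
qed

lemma options_single: "options {#k#} = path_moves k"
proof -
  have "rel_mset (\<lambda>k r. r \<in> path_moves k) {#k#} M \<longleftrightarrow> (\<exists>r \<in> path_moves k. M = {#r#})" for M
    by (auto dest!: msed_rel_invL intro: rel_mset_Plus rel_mset_Zero)
  then have "options {#k#} = {\<Sum>\<^sub># M | M. \<exists>r \<in> path_moves k. M = {#r#}}"
    by (simp add: options_def)
  also have "\<dots> = path_moves k" by (auto intro: exI[of _ "{#_#}"])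
  finally show ?thesis .
qed

lemma finite_path_moves: "finite (path_moves k)"
  by (simp add: path_moves_eq_vertex_deletions)

lemma finite_rel_mset:
  assumes "\<And>x. finite {y. R x y}"
  shows "finite {N. rel_mset R M N}"
proof (induction M)
  case empty
  then show ?case by simp
next
  case (add a M)
  have "{N. rel_mset R (add_mset a M) N}
      \<subseteq> (\<lambda>(b, N). add_mset b N) ` ({b. R a b} \<times> {N. rel_mset R M N})"
    by (force dest!: msed_rel_invL)
  then show ?case
    by (rule finite_subset) (use add assms in auto)
qed

lemma finite_option_set: "finite (options G)"
proof -
  have "options G \<subseteq> sum_mset ` {M. rel_mset (\<lambda>k r. r \<in> path_moves k) G M}"
    by (auto simp: options_def)
  then show ?thesis
    by (rule finite_subset) (simp add: finite_rel_mset finite_path_moves)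
qed

lemma sum_path_moves_less: "r \<in> path_moves k \<Longrightarrow> \<Sum>\<^sub># r < k"
  by (auto simp: path_moves_def split: if_splits)

lemma sum_options_less:
  assumes "H \<in> options G"
  shows "\<Sum>\<^sub># H < \<Sum>\<^sub># G"
proof -
  have *: "\<Sum>\<^sub># (\<Sum>\<^sub># M) + size G \<le> \<Sum>\<^sub># G"
    if "rel_mset (\<lambda>k r. r \<in> path_moves k) G M" for M and G :: "nat multiset"
    using that
  proof (induction G arbitrary: M)
    case empty
    then show ?case by simp
  next
    case (add k G)
    then obtain N r where "M = add_mset r N" "r \<in> path_moves k"
      and "\<Sum>\<^sub># (\<Sum>\<^sub># N) + size G \<le> \<Sum>\<^sub># G"
      by (blast dest: msed_rel_invL)
    then show ?case using sum_path_moves_less[of r k] by simp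
  qed
  show ?thesis
    using assms *[of G] nonempty_has_size[of G]
    by (fastforce simp: options_def split: if_splits)
qed

function misere_remoteness :: "nat multiset \<Rightarrow> nat" where
  "misere_remoteness G =
    (let V = misere_remoteness ` options G in
     if options G = {} then 0
     else if \<exists>r \<in> V. odd r then 1 + Min {r \<in> V. odd r}
     else 1 + Max V)"
  by auto
termination
  by (relation "measure sum_mset") (auto dest: sum_options_less)

declare misere_remoteness.simps [simp del]

end

theory Submission
  imports Defs
begin

text \<open>
  A component \<open>P\<^sub>1\<close> or \<open>P\<^sub>2\<close> is necessarily deleted by the next move, so a position without
  \<open>P\<^sub>0\<close> containing one has remoteness 1. Every \<open>P\<^sub>n\<close> with \<open>n \<ge> 3\<close> has such a position as an
  option, namely \<open>P\<^sub>1\<close>, \<open>P\<^sub>2\<close> or \<open>P\<^sub>1 + P\<^bsub>n-4\<^esub>\<close>.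
\<close>

lemma misere_remoteness_terminal:
  "options G = {} \<Longrightarrow> misere_remoteness G = 0"
  by (subst misere_remoteness.simps) simp

lemma options_nonempty:
  assumes "G \<noteq> {#}" "0 \<notin># G"
  shows "options G \<noteq> {}"
proof -
  \<comment> \<open>Deleting an end vertex is a uniform choice: truncated subtraction makes
    \<open>k - 2\<close> equal to 0 for \<open>k = 1\<close> and \<open>k = 2\<close>, as
    \<open>path_moves\<close> demands there.\<close>
  let ?move = "\<lambda>k. {#k - 2#} :: nat multiset"
  have "?move k \<in> path_moves k" if "k \<noteq> 0" for k
    using that by (auto simp: path_moves_def)
  then have "rel_mset (\<lambda>k r. r \<in> path_moves k) G (image_mset ?move G)"
    using assms(2)
  proof (induction G)
    case (add k G)
    then show ?case by (auto intro!: rel_mset_Plus)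
  qed (simp add: rel_mset_Zero)
  then show ?thesis
    using assms(1) by (auto simp: options_def)
qed

text \<open>The only result for such a component is \<open>{#0#}\<close>, and summing the chosen
  results keeps that 0.\<close>

lemma zero_component_option:
  assumes "k \<in># G" "k = 1 \<or> k = 2" "H \<in> options G"
  shows "0 \<in># H"
proof -
  obtain M where M: "H = \<Sum>\<^sub># M" "rel_mset (\<lambda>k r. r \<in> path_moves k) G M"
    using assms(3) by (auto simp: options_def split: if_splits)
  obtain G' where "G = add_mset k G'"
    using assms(1) by (metis mset_add)
  with M(2) obtain r N where "M = add_mset r N" "r \<in> path_moves k"
    by (blast dest: msed_rel_invL)
  then show ?thesis
    using M(1) assms(2) by (auto simp: path_moves_def)
qed

lemma misere_remoteness_eq_1:
  assumes "0 \<notin># G" "k \<in># G" "k = 1 \<or> k = 2"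
  shows "misere_remoteness G = 1"
proof -
  have "misere_remoteness H = 0" if "H \<in> options G" for H
    using zero_component_option[OF assms(2,3) that]
    by (simp add: misere_remoteness_terminal options_empty_if_zero_component)
  moreover have "options G \<noteq> {}"
    using assms(1,2) by (intro options_nonempty) auto
  \<comment> \<open>No option value is odd, so the \<open>Max\<close> clause applies and gives 1 +
    0.\<close>
  ultimately have "misere_remoteness ` options G = {0}" by force
  then show ?thesis
    using \<open>options G \<noteq> {}\<close> by (subst misere_remoteness.simps) simp
qed

text \<open>Since 1 is the least odd number, one option of remoteness 1 fixes the minimum, whatever
  the other options are.\<close>

lemma misere_remoteness_eq_2:
  assumes "H \<in> options G" "misere_remoteness H = 1"
  shows "misere_remoteness G = 2"
proof -
  let ?V = "misere_remoteness ` options G"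
  have one: "1 \<in> ?V"
    using assms by force
  have "Min {r \<in> ?V. odd r} = 1"
  proof (rule Min_eqI)
    show "1 \<le> r" if "r \<in> {r \<in> ?V. odd r}" for r
      using that by (auto elim: oddE)
  qed (use one finite_option_set in auto)
  moreover have "\<exists>r \<in> ?V. odd r"
    using one odd_one by blast
  ultimately show ?thesis
    using assms(1) by (subst misere_remoteness.simps) (auto simp: Let_def)
qed

theorem theorem3:
  shows "misere_remoteness {#1#} = 1 \<and> misere_remoteness {#2#} = 1 \<and>
    (\<forall>n \<ge> 3. misere_remoteness {#n#} = 2)"
proof (intro conjI allI impI)
  show "misere_remoteness {#1#} = 1"
    by (rule misere_remoteness_eq_1[of _ 1]) auto
  show "misere_remoteness {#2#} = 1"
    by (rule misere_remoteness_eq_1[of _ 2]) auto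
  fix n :: nat
  assume "n \<ge> 3"
  then consider "n = 3" | "n = 4" | "n \<ge> 5" by linarith
  then obtain H k where "H \<in> path_moves n" "0 \<notin># H" "k \<in># H" "k = 1 \<or> k = 2"
  proof cases
    case 1
    then show ?thesis by (intro that[of "{#1#}" 1]) (auto simp: path_moves_def)
  next
    case 2
    then show ?thesis by (intro that[of "{#2#}" 2]) (auto simp: path_moves_def)
  next
    case 3
    \<comment> \<open>Deleting the third vertex leaves paths on 1 and \<open>n - 4\<close> vertices;
      \<open>n \<ge> 5\<close> makes the second piece nonempty, which fails for
      \<open>n = 4\<close>.\<close>
    then have "\<exists>i j. {#1, n - 4#} = {#i, j#} \<and> 1 \<le> i \<and> i \<le> j \<and> i + j = n - 3"
      by (intro exI[of _ 1] exI[of _ "n - 4"]) auto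
    with 3 show ?thesis by (intro that[of "{#1, n - 4#}" 1]) (auto simp: path_moves_def)
  qed
  then show "misere_remoteness {#n#} = 2"
    by (intro misere_remoteness_eq_2[of H] misere_remoteness_eq_1[of H k])
      (simp_all only: options_single not_False_eq_True)
qed

end
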